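(* Let $G=(V,E)$ be a finite simple graph and let $g\in\mathbb{R}^E$ be a uniform-sign vector. Then $g$ is a circuit of the rank inequality system of $G$ if and only if $g$ is, up to sign, a unit vector, i.e. there is an edge $e\in E$ with $g=g_e$ or $g=-g_e$, where $g_e\in\mathbb{R}^E$ has entry $1$ at $e$ and $0$ elsewhere.
   Context: A vector is mixed-sign if it has at least one positive and at least one negative entry; otherwise it is uniform-sign. The rank inequality system of $G$ is $\sum_{e\in E(G[U])}x(e)\le |U|-1$ for all $\emptyset\neq U\subseteq V$, where $G[U]$ is the subgraph induced by $U$; let $B$ be its constraint matrix, so $(Bx)_U=\sum_{e\in E(G[U])}x(e)$. A circuit of the system is a vector $g\in\mathbb{R}^E\setminus\{0\}$ with coprime integer components such that the support of $Bg$ is inclusion-minimal among the supports of $\{Bx : x\in\mathbb{R}^E\setminus\{0\}\}$. *)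

theory Defs
  imports Complex_Main
begin

definition finite_simple_graph :: "'v set \<Rightarrow> 'v set set \<Rightarrow> bool" where
  "finite_simple_graph V E \<longleftrightarrow> finite V \<and> E \<subseteq> {e. e \<subseteq> V \<and> card e = 2}"

text \<open>
  For a finite index set \<open>J\<close>, a vector of the space \<open>\<real>\<^sup>J\<close> is a real-valued function that is
  zero outside \<open>J\<close>, so that equality of vectors is equality of functions.
\<close>

definition real_vectors :: "'j set \<Rightarrow> ('j \<Rightarrow> real) set" where
  "real_vectors J = {x. \<forall>j. j \<notin> J \<longrightarrow> x j = 0}"

definition zero_vector :: "'j \<Rightarrow> real" where
  "zero_vector = (\<lambda>_. 0)"

definition unit_vector :: "'j \<Rightarrow> 'j \<Rightarrow> real" where
  "unit_vector i = (\<lambda>j. if j = i then 1 else 0)"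

definition mixed_sign :: "'j set \<Rightarrow> ('j \<Rightarrow> real) \<Rightarrow> bool" where
  "mixed_sign J x \<longleftrightarrow> (\<exists>i\<in>J. x i > 0) \<and> (\<exists>j\<in>J. x j < 0)"

definition uniform_sign :: "'j set \<Rightarrow> ('j \<Rightarrow> real) \<Rightarrow> bool" where
  "uniform_sign J x \<longleftrightarrow> \<not> mixed_sign J x"

definition coprime_integer_vector :: "'j set \<Rightarrow> ('j \<Rightarrow> real) \<Rightarrow> bool" where
  "coprime_integer_vector J x \<longleftrightarrow>
     (\<exists>z :: 'j \<Rightarrow> int. (\<forall>j\<in>J. x j = of_int (z j)) \<and> Gcd (z ` J) = 1)"

definition mat_vec :: "'j set \<Rightarrow> ('i \<Rightarrow> 'j \<Rightarrow> real) \<Rightarrow> ('j \<Rightarrow> real) \<Rightarrow> 'i \<Rightarrow> real" where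
  "mat_vec J B x i = (\<Sum>j\<in>J. B i j * x j)"

definition support_on :: "'i set \<Rightarrow> ('i \<Rightarrow> real) \<Rightarrow> 'i set" where
  "support_on I y = {i \<in> I. y i \<noteq> 0}"

text \<open>
  Circuits of a system \<open>Bx \<le> d\<close> with rows indexed by \<open>I\<close> and columns indexed by \<open>J\<close>;
  the right-hand side \<open>d\<close> plays no role.
\<close>

definition is_circuit :: "'i set \<Rightarrow> 'j set \<Rightarrow> ('i \<Rightarrow> 'j \<Rightarrow> real) \<Rightarrow> ('j \<Rightarrow> real) \<Rightarrow> bool" where
  "is_circuit I J B g \<longleftrightarrow>
     g \<in> real_vectors J - {zero_vector} \<and>
     coprime_integer_vector J g \<and>
     \<not> (\<exists>x \<in> real_vectors J - {zero_vector}.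
          support_on I (mat_vec J B x) \<subset> support_on I (mat_vec J B g))"

definition induced_edges :: "'v set set \<Rightarrow> 'v set \<Rightarrow> 'v set set" where
  "induced_edges E U = {e \<in> E. e \<subseteq> U}"

definition rank_rows :: "'v set \<Rightarrow> 'v set set" where
  "rank_rows V = {U. U \<noteq> {} \<and> U \<subseteq> V}"

definition rank_matrix :: "'v set set \<Rightarrow> 'v set \<Rightarrow> 'v set \<Rightarrow> real" where
  "rank_matrix E U e = (if e \<in> induced_edges E U then 1 else 0)"

lemma mat_vec_rank_matrix:
  assumes "finite E"
  shows "mat_vec E (rank_matrix E) x U = (\<Sum>e\<in>induced_edges E U. x e)"
proof -
  have "induced_edges E U \<subseteq> E"
    by (auto simp: induced_edges_def)
  then have "(\<Sum>e\<in>induced_edges E U. x e) = (\<Sum>e\<in>E. if e \<in> induced_edges E U then x e else 0)"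
    using assms by (simp add: sum.inter_restrict [symmetric] Int_absorb1)
  also have "\<dots> = mat_vec E (rank_matrix E) x U"
    unfolding mat_vec_def rank_matrix_def by (intro sum.cong) auto
  finally show ?thesis by simp
qed

definition rank_system_circuit :: "'v set \<Rightarrow> 'v set set \<Rightarrow> ('v set \<Rightarrow> real) \<Rightarrow> bool" where
  "rank_system_circuit V E = is_circuit (rank_rows V) E (rank_matrix E)"

end

theory Submission
  imports Defs
begin

text \<open>
  Both directions rest on two observations about supports of \<open>Bx\<close>. First, an edge \<open>f\<close>, read as a
  two-element vertex set, induces only itself, so \<open>(Bx)\<^sub>f = x f\<close>: the support of \<open>x\<close> is visible in
  that of \<open>Bx\<close>. The support of \<open>B\<close> applied to the unit vector of \<open>e\<close> consists of the vertex sets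
  containing \<open>e\<close>, and the only edge among these is \<open>e\<close>; hence any \<open>x\<close> for which \<open>Bx\<close> has its support
  inside this family is a multiple of that unit vector (\<open>vanishes_off_edge\<close>). If nonzero, such an
  \<open>x\<close> attains the whole family, so unit vectors and their negatives are circuits. Second, entries
  of equal sign cannot cancel, so for a uniform-sign \<open>g\<close> with \<open>g e \<noteq> 0\<close> every vertex set containing
  \<open>e\<close> lies in the support of \<open>Bg\<close> (\<open>uniform_sign_support\<close>). Minimality then makes the two supports
  equal, so \<open>g\<close> is a multiple of the unit vector of \<open>e\<close>, and coprimality leaves the factors \<open>1\<close>
  and \<open>-1\<close>.
\<close>

abbreviation rank_support :: "'v set \<Rightarrow> 'v set set \<Rightarrow> ('v set \<Rightarrow> real) \<Rightarrow> 'v set set" where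
  "rank_support V E x \<equiv> support_on (rank_rows V) (mat_vec E (rank_matrix E) x)"

lemma finite_edges:
  assumes "finite_simple_graph V E"
  shows "finite E"
  using assms unfolding finite_simple_graph_def
  by (auto intro: finite_subset[of E "Pow V"])

lemma edge_subset_edge:
  assumes "finite_simple_graph V E" "e \<in> E" "f \<in> E" "e \<subseteq> f"
  shows "e = f"
proof -
  have "card e = 2" "card f = 2" "finite f"
    using assms by (auto simp: finite_simple_graph_def intro: finite_subset)
  then show ?thesis using card_subset_eq \<open>e \<subseteq> f\<close> by metis
qed

lemma edge_row:
  assumes "finite_simple_graph V E" "e \<in> E"
  shows "e \<in> rank_rows V"
  using assms by (auto simp: finite_simple_graph_def rank_rows_def)

lemma edge_in_rank_support_iff:
  assumes "finite_simple_graph V E" "f \<in> E"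
  shows "f \<in> rank_support V E x \<longleftrightarrow> x f \<noteq> 0"
proof -
  have "induced_edges E f = {f}"
    using edge_subset_edge[OF assms(1)] assms(2) by (auto simp: induced_edges_def)
  then show ?thesis
    using edge_row[OF assms] by (simp add: support_on_def mat_vec_rank_matrix finite_edges[OF assms(1)])
qed

lemma rank_support_multiple_unit:
  assumes "finite_simple_graph V E" "e \<in> E" "x e \<noteq> 0" "\<And>f. f \<noteq> e \<Longrightarrow> x f = 0"
  shows "rank_support V E x = {U \<in> rank_rows V. e \<subseteq> U}"
proof -
  have "mat_vec E (rank_matrix E) x U = (\<Sum>f\<in>E. if f = e then rank_matrix E U e * x e else 0)" for U
    unfolding mat_vec_def by (intro sum.cong) (auto simp: assms(4))
  then show ?thesis
    using assms(2,3) finite_edges[OF assms(1)]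
    by (auto simp: support_on_def rank_matrix_def induced_edges_def)
qed

text \<open>
  An edge \<open>f\<close> with \<open>x f \<noteq> 0\<close> is itself a row in the support of \<open>Bx\<close>, so it would have to contain
  \<open>e\<close>; but two-element sets are comparable only if they are equal.
\<close>

lemma vanishes_off_edge:
  assumes "finite_simple_graph V E" "e \<in> E" "x \<in> real_vectors E"
    and "rank_support V E x \<subseteq> {U \<in> rank_rows V. e \<subseteq> U}" "f \<noteq> e"
  shows "x f = 0"
proof (rule ccontr)
  assume "x f \<noteq> 0"
  then have f: "f \<in> E" using assms(3) by (auto simp: real_vectors_def)
  then have "e \<subseteq> f"
    using edge_in_rank_support_iff[OF assms(1) f] \<open>x f \<noteq> 0\<close> assms(4) by blast
  then show False using edge_subset_edge[OF assms(1,2) f] assms(5) by simp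
qed

text \<open>
  The absence of cancellation: a sum of entries of equal sign vanishes only if each entry does.
\<close>

lemma uniform_sign_support:
  assumes "finite_simple_graph V E" "uniform_sign E g" "e \<in> E" "g e \<noteq> 0"
  shows "{U \<in> rank_rows V. e \<subseteq> U} \<subseteq> rank_support V E g"
proof
  fix U assume "U \<in> {U \<in> rank_rows V. e \<subseteq> U}"
  then have U: "U \<in> rank_rows V" and e: "e \<in> induced_edges E U"
    using assms(3) by (auto simp: induced_edges_def)
  have sub: "induced_edges E U \<subseteq> E" by (auto simp: induced_edges_def)
  then have fin: "finite (induced_edges E U)"
    using finite_edges[OF assms(1)] finite_subset by blast
  have "(\<forall>f\<in>E. g f \<ge> 0) \<or> (\<forall>f\<in>E. g f \<le> 0)"
    using assms(2) by (force simp: uniform_sign_def mixed_sign_def not_less)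
  then have "(\<Sum>f\<in>induced_edges E U. g f) \<noteq> 0"
  proof
    assume "\<forall>f\<in>E. g f \<ge> 0"
    then show ?thesis using sum_nonneg_eq_0_iff[OF fin, of g] sub e assms(4) by blast
  next
    assume "\<forall>f\<in>E. g f \<le> 0"
    then show ?thesis
      using sum_nonneg_eq_0_iff[OF fin, of "\<lambda>f. - g f"] sub e assms(4) by (auto simp: sum_negf)
  qed
  then show "U \<in> rank_support V E g"
    using U by (simp add: support_on_def mat_vec_rank_matrix finite_edges[OF assms(1)])
qed

text \<open>
  The only entry that can be nonzero divides all the others, so its absolute value is the gcd
  of all entries.
\<close>

lemma coprime_integer_multiple_unit_iff:
  assumes "e \<in> E" "\<And>f. f \<noteq> e \<Longrightarrow> x f = 0"
  shows "coprime_integer_vector E x \<longleftrightarrow> x = unit_vector e \<or> x = - unit_vector e"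
proof
  assume "coprime_integer_vector E x"
  then obtain z :: "'a \<Rightarrow> int" where z: "\<forall>f\<in>E. x f = of_int (z f)" "Gcd (z ` E) = 1"
    by (auto simp: coprime_integer_vector_def)
  have "z e dvd z f" if "f \<in> E" for f
    using z(1) that assms(2)[of f] by (cases "f = e") auto
  then have "z e dvd Gcd (z ` E)" by (auto intro: Gcd_greatest)
  then have "\<bar>z e\<bar> = 1" using z(2) by simp
  then have "x e = 1 \<or> x e = -1" using z(1) assms(1) by (auto simp: abs_if split: if_splits)
  then show "x = unit_vector e \<or> x = - unit_vector e"
    using assms(2) by (auto simp: unit_vector_def fun_eq_iff)
next
  assume x: "x = unit_vector e \<or> x = - unit_vector e"
  define z :: "'a \<Rightarrow> int" where "z = (\<lambda>f. if f = e then (if x = unit_vector e then 1 else -1) else 0)"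
  have "Gcd (z ` E) dvd z e" using assms(1) by (auto intro: Gcd_dvd)
  moreover have "is_unit (z e)" by (simp add: z_def)
  ultimately have "is_unit (Gcd (z ` E))" by (rule dvd_trans)
  then have "Gcd (z ` E) = 1" by simp
  moreover have "\<forall>f\<in>E. x f = of_int (z f)"
    using x by (auto simp: z_def unit_vector_def)
  ultimately show "coprime_integer_vector E x" by (auto simp: coprime_integer_vector_def)
qed

theorem lemma4p2:
  fixes V :: "'v set" and E :: "'v set set" and g :: "'v set \<Rightarrow> real"
  assumes "finite_simple_graph V E"
    and "g \<in> real_vectors E"
    and "uniform_sign E g"
  shows "rank_system_circuit V E g \<longleftrightarrow>
    (\<exists>e\<in>E. g = unit_vector e \<or> g = - unit_vector e)"
proof
  assume "rank_system_circuit V E g"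
  then have nz: "g \<noteq> zero_vector" and cop: "coprime_integer_vector E g"
    and minimal: "\<And>x. x \<in> real_vectors E - {zero_vector} \<Longrightarrow>
      \<not> rank_support V E x \<subset> rank_support V E g"
    by (auto simp: rank_system_circuit_def is_circuit_def)
  from nz obtain e where ge: "g e \<noteq> 0" by (auto simp: zero_vector_def)
  then have e: "e \<in> E" using assms(2) by (auto simp: real_vectors_def)
  have unit: "rank_support V E (unit_vector e) = {U \<in> rank_rows V. e \<subseteq> U}"
    by (rule rank_support_multiple_unit[OF assms(1) e]) (auto simp: unit_vector_def)
  have "unit_vector e \<in> real_vectors E - {zero_vector}"
    using e by (auto simp: real_vectors_def unit_vector_def zero_vector_def fun_eq_iff)
  from minimal[OF this] have "rank_support V E g \<subseteq> {U \<in> rank_rows V. e \<subseteq> U}"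
    using uniform_sign_support[OF assms(1,3) e ge] unit by blast
  then have "g f = 0" if "f \<noteq> e" for f
    using vanishes_off_edge[OF assms(1) e assms(2)] that by blast
  then show "\<exists>e\<in>E. g = unit_vector e \<or> g = - unit_vector e"
    using coprime_integer_multiple_unit_iff[OF e, of g] cop e by blast
next
  assume "\<exists>e\<in>E. g = unit_vector e \<or> g = - unit_vector e"
  then obtain e where e: "e \<in> E" and g: "g = unit_vector e \<or> g = - unit_vector e" by blast
  have off: "g f = 0" if "f \<noteq> e" for f
    using g that by (elim disjE) (simp_all add: unit_vector_def)
  have ge: "g e \<noteq> 0" using g by (auto simp: unit_vector_def)
  have supp_g: "rank_support V E g = {U \<in> rank_rows V. e \<subseteq> U}"
    using rank_support_multiple_unit[OF assms(1) e, of g] ge off by blast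
  have "\<not> rank_support V E x \<subset> rank_support V E g"
    if x: "x \<in> real_vectors E - {zero_vector}" for x
  proof
    assume less: "rank_support V E x \<subset> rank_support V E g"
    have off_x: "x f = 0" if "f \<noteq> e" for f
      using vanishes_off_edge[OF assms(1) e, of x] x less supp_g that by blast
    moreover have "x e \<noteq> 0"
      using x off_x by (auto simp: zero_vector_def fun_eq_iff) metis
    ultimately show False
      using rank_support_multiple_unit[OF assms(1) e, of x] supp_g less by blast
  qed
  moreover have "coprime_integer_vector E g"
    using coprime_integer_multiple_unit_iff[OF e, of g] off g by blast
  moreover have "g \<noteq> zero_vector" using ge by (auto simp: zero_vector_def)
  ultimately show "rank_system_circuit V E g"
    using assms(2) by (auto simp: rank_system_circuit_def is_circuit_def)
qed

end
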